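(* Let $n\ge 2$. For Green's relations on the additive semigroup $(A^+(B_n),+)$: (1) the number of $\mathcal{R}$-classes is $(n!)n+n^3+n+1$; (2) the number of $\mathcal{L}$-classes is $(n!)n^2+n^3+n+1$; (3) the number of $\mathcal{D}$-classes is $(n!)n+n^2+2$.
   Context: For $n\ge 1$ let $[n]=\{1,\dots,n\}$. The Brandt semigroup $(B_n,+)$ has underlying set $B_n=([n]\times[n])\cup\{\vartheta\}$ with $(i,j)+(k,l)=(i,l)$ if $j=k$, $(i,j)+(k,l)=\vartheta$ if $j\ne k$, and $\alpha+\vartheta=\vartheta+\alpha=\vartheta$ for all $\alpha\in B_n$. $M(B_n)$ is the set of all maps $B_n\to B_n$; arguments are written on the left of functions. It carries pointwise addition $\alpha(f+g)=\alpha f+\alpha g$ and composition $\alpha(f\circ g)=(\alpha f)g$. An affine map over $B_n$ is a map of the form $g+h$ with $g$ an endomorphism of the semigroup $(B_n,+)$ (not required to fix $\vartheta$) and $h\in M(B_n)$ a constant map. $A^+(B_n)$ (the affine near-semiring over $B_n$) is the smallest subset of $M(B_n)$ that contains all affine maps and is closed under $+$ and $\circ$. *)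

theory Defs
  imports Complex_Main "HOL-Library.FuncSet"
begin

section \<open>Brandt semigroups\<close>

text \<open>
  The operation does not depend on n, so it is defined on the whole type; the semigroup
  \<open>B\<^sub>n\<close> is its restriction to the carrier \<open>brandt n\<close>.
\<close>

datatype brandt_elem = Pr nat nat | Theta

fun brandt_add :: "brandt_elem \<Rightarrow> brandt_elem \<Rightarrow> brandt_elem" where
  "brandt_add (Pr i j) (Pr k l) = (if j = k then Pr i l else Theta)"
| "brandt_add Theta \<beta> = Theta"
| "brandt_add \<alpha> Theta = Theta"

definition brandt :: "nat \<Rightarrow> brandt_elem set" where
  "brandt n = {Pr i j | i j. i \<in> {1..n} \<and> j \<in> {1..n}} \<union> {Theta}"


section \<open>Maps on a Brandt semigroup and the affine near-semiring\<close>

text \<open>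
  Self-maps of \<open>B\<^sub>n\<close> are represented by extensional functions (\<open>undefined\<close> off the carrier),
  so that equality of representatives is equality of maps.
\<close>

definition brandt_maps :: "nat \<Rightarrow> (brandt_elem \<Rightarrow> brandt_elem) set" where
  "brandt_maps n = brandt n \<rightarrow>\<^sub>E brandt n"

definition pw_add ::
  "nat \<Rightarrow> (brandt_elem \<Rightarrow> brandt_elem) \<Rightarrow> (brandt_elem \<Rightarrow> brandt_elem) \<Rightarrow> (brandt_elem \<Rightarrow> brandt_elem)" where
  "pw_add n f g = (\<lambda>\<alpha>\<in>brandt n. brandt_add (f \<alpha>) (g \<alpha>))"

text \<open>Arguments are written on the left, so \<open>f \<circ> g\<close> applies \<open>f\<close> first.\<close>

definition fn_comp ::
  "nat \<Rightarrow> (brandt_elem \<Rightarrow> brandt_elem) \<Rightarrow> (brandt_elem \<Rightarrow> brandt_elem) \<Rightarrow> (brandt_elem \<Rightarrow> brandt_elem)" where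
  "fn_comp n f g = compose (brandt n) g f"

definition brandt_endos :: "nat \<Rightarrow> (brandt_elem \<Rightarrow> brandt_elem) set" where
  "brandt_endos n = {g \<in> brandt_maps n. \<forall>\<alpha>\<in>brandt n. \<forall>\<beta>\<in>brandt n.
     g (brandt_add \<alpha> \<beta>) = brandt_add (g \<alpha>) (g \<beta>)}"

definition const_maps :: "nat \<Rightarrow> (brandt_elem \<Rightarrow> brandt_elem) set" where
  "const_maps n = {(\<lambda>\<alpha>\<in>brandt n. c) | c. c \<in> brandt n}"

definition affine_maps :: "nat \<Rightarrow> (brandt_elem \<Rightarrow> brandt_elem) set" where
  "affine_maps n = {pw_add n g h | g h. g \<in> brandt_endos n \<and> h \<in> const_maps n}"

inductive_set affine_nsr :: "nat \<Rightarrow> (brandt_elem \<Rightarrow> brandt_elem) set" for n :: nat where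
  affine: "f \<in> affine_maps n \<Longrightarrow> f \<in> affine_nsr n"
| add: "f \<in> affine_nsr n \<Longrightarrow> g \<in> affine_nsr n \<Longrightarrow> pw_add n f g \<in> affine_nsr n"
| comp: "f \<in> affine_nsr n \<Longrightarrow> g \<in> affine_nsr n \<Longrightarrow> fn_comp n f g \<in> affine_nsr n"


section \<open>Green's relations of a semigroup with carrier S and operation p\<close>

text \<open>The principal one-sided ideals \<open>a S\<^sup>1\<close> and \<open>S\<^sup>1 a\<close>.\<close>

definition right_ideal :: "'a set \<Rightarrow> ('a \<Rightarrow> 'a \<Rightarrow> 'a) \<Rightarrow> 'a \<Rightarrow> 'a set" where
  "right_ideal S p a = insert a {p a s | s. s \<in> S}"

definition left_ideal :: "'a set \<Rightarrow> ('a \<Rightarrow> 'a \<Rightarrow> 'a) \<Rightarrow> 'a \<Rightarrow> 'a set" where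
  "left_ideal S p a = insert a {p s a | s. s \<in> S}"

definition green_R :: "'a set \<Rightarrow> ('a \<Rightarrow> 'a \<Rightarrow> 'a) \<Rightarrow> 'a rel" where
  "green_R S p = {(a, b) \<in> S \<times> S. right_ideal S p a = right_ideal S p b}"

definition green_L :: "'a set \<Rightarrow> ('a \<Rightarrow> 'a \<Rightarrow> 'a) \<Rightarrow> 'a rel" where
  "green_L S p = {(a, b) \<in> S \<times> S. left_ideal S p a = left_ideal S p b}"

text \<open>
  \<open>\<D>\<close> is the join of \<open>\<L>\<close> and \<open>\<R>\<close>, the least equivalence relation on S containing both. As
  their union is reflexive on S and symmetric, this is its transitive closure.
\<close>

definition green_D :: "'a set \<Rightarrow> ('a \<Rightarrow> 'a \<Rightarrow> 'a) \<Rightarrow> 'a rel" where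
  "green_D S p = (green_L S p \<union> green_R S p)\<^sup>+"

lemma equiv_green_R: "equiv S (green_R S p)"
  by (auto simp: equiv_def refl_on_def sym_def trans_def green_R_def)

lemma equiv_green_L: "equiv S (green_L S p)"
  by (auto simp: equiv_def refl_on_def sym_def trans_def green_L_def)

lemma equiv_green_D: "equiv S (green_D S p)"
proof (rule equivI)
  show "green_D S p \<subseteq> S \<times> S"
    unfolding green_D_def by (rule trancl_subset_Sigma) (auto simp: green_L_def green_R_def)
  show "refl_on S (green_D S p)"
    by (auto simp: refl_on_def green_D_def green_L_def)
  have "sym (green_L S p \<union> green_R S p)"
    by (auto simp: sym_def green_L_def green_R_def)
  then show "sym (green_D S p)"
    unfolding green_D_def by (rule sym_trancl)
  show "trans (green_D S p)"
    unfolding green_D_def by (rule trans_trancl)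
qed

end

theory Submission
  imports Defs "HOL-Combinatorics.Permutations"
begin

text \<open>
  An endomorphism of \<open>B\<^sub>n\<close> is constant or induced by a permutation \<open>\<sigma>\<close> of \<open>[n]\<close>. Hence \<open>A\<^sup>+(B\<^sub>n)\<close>
  consists of the constants, the maps \<open>(i,k) \<mapsto> (i\<sigma>,q)\<close> supported on the column of a fixed \<open>k\<close>,
  and the maps supported on a single pair. For \<open>n \<ge> 2\<close> these are pairwise distinct. Right
  addition can change only the second components of the nonzero values, and constants suffice for
  changing them all to any other element of \<open>[n]\<close>. Dually for left addition, except that a column map is
  alone in its \<open>\<L>\<close>-class, since no element takes the values \<open>(i\<rho>,i\<sigma>)\<close> on a whole column.
\<close>

section \<open>Codes for the elements of the affine near-semiring\<close>

datatype code = Zero | Const nat nat | Column nat nat "nat \<Rightarrow> nat" | Point nat nat nat nat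

text \<open>A permutation in the sense of \<open>permutes\<close> fixes every number outside
  \<open>{1..n}\<close>, so two columns cannot differ merely off the carrier. This lets
  \<open>decode\<close> be injective.\<close>

fun codes :: "nat \<Rightarrow> code \<Rightarrow> bool" where
  "codes n Zero = True"
| "codes n (Const p q) = (p \<in> {1..n} \<and> q \<in> {1..n})"
| "codes n (Column k q \<sigma>) = (k \<in> {1..n} \<and> q \<in> {1..n} \<and> \<sigma> permutes {1..n})"
| "codes n (Point i k p q) = (i \<in> {1..n} \<and> k \<in> {1..n} \<and> p \<in> {1..n} \<and> q \<in> {1..n})"

fun apply_code :: "code \<Rightarrow> brandt_elem \<Rightarrow> brandt_elem" where
  "apply_code Zero \<alpha> = Theta"
| "apply_code (Const p q) \<alpha> = Pr p q"
| "apply_code (Column k q \<sigma>) Theta = Theta"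
| "apply_code (Column k q \<sigma>) (Pr i j) = (if j = k then Pr (\<sigma> i) q else Theta)"
| "apply_code (Point i k p q) \<alpha> = (if \<alpha> = Pr i k then Pr p q else Theta)"

definition decode :: "nat \<Rightarrow> code \<Rightarrow> brandt_elem \<Rightarrow> brandt_elem" where
  "decode n c = (\<lambda>\<alpha>\<in>brandt n. apply_code c \<alpha>)"

text \<open>The inverses locate the one surviving row: \<open>(p,q) + (\<sigma> i, r)\<close> is
  nonzero only for \<open>\<sigma> i = q\<close>, and \<open>(\<sigma> i, p) + (\<tau> i, q)\<close>
  only for \<open>\<tau> i = p\<close>. This is how points arise from columns.\<close>

fun code_add :: "code \<Rightarrow> code \<Rightarrow> code" where
  "code_add Zero c = Zero"
| "code_add c Zero = Zero"
| "code_add (Const p q) (Const r s) = (if q = r then Const p s else Zero)"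
| "code_add (Const p q) (Column k r \<sigma>) = Point (inv \<sigma> q) k p r"
| "code_add (Const p q) (Point i k r s) = (if q = r then Point i k p s else Zero)"
| "code_add (Column k p \<sigma>) (Const q r) = (if p = q then Column k r \<sigma> else Zero)"
| "code_add (Column k p \<sigma>) (Column l q \<tau>) =
     (if k = l then Point (inv \<tau> p) k (\<sigma> (inv \<tau> p)) q else Zero)"
| "code_add (Column k p \<sigma>) (Point i l r s) = (if k = l \<and> p = r then Point i k (\<sigma> i) s else Zero)"
| "code_add (Point i k p q) (Const r s) = (if q = r then Point i k p s else Zero)"
| "code_add (Point i k p q) (Column l r \<sigma>) = (if k = l \<and> \<sigma> i = q then Point i k p r else Zero)"
| "code_add (Point i k p q) (Point j l r s) =
     (if i = j \<and> k = l \<and> q = r then Point i k p s else Zero)"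

text \<open>The first argument is applied first, hence \<open>\<tau> \<circ> \<sigma>\<close>. A
  constant in second place wins even over \<open>Zero\<close>, because it sends \<open>Theta\<close>
  to a pair; its clause therefore precedes the one for \<open>Zero\<close>.\<close>

fun code_comp :: "code \<Rightarrow> code \<Rightarrow> code" where
  "code_comp c Zero = Zero"
| "code_comp c (Const p q) = Const p q"
| "code_comp Zero c = Zero"
| "code_comp (Const a b) (Column l q \<tau>) = (if b = l then Const (\<tau> a) q else Zero)"
| "code_comp (Column k p \<sigma>) (Column l q \<tau>) = (if p = l then Column k q (\<tau> \<circ> \<sigma>) else Zero)"
| "code_comp (Point i k a b) (Column l q \<tau>) = (if b = l then Point i k (\<tau> a) q else Zero)"
| "code_comp (Const a b) (Point j l r s) = (if a = j \<and> b = l then Const r s else Zero)"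
| "code_comp (Column k p \<sigma>) (Point j l r s) = (if p = l then Point (inv \<sigma> j) k r s else Zero)"
| "code_comp (Point i k a b) (Point j l r s) = (if a = j \<and> b = l then Point i k r s else Zero)"

section \<open>Correctness of the operations on codes\<close>

lemma Theta_in_brandt [simp]: "Theta \<in> brandt n"
  by (simp add: brandt_def)

lemma Pr_in_brandt [simp]: "Pr i j \<in> brandt n \<longleftrightarrow> i \<in> {1..n} \<and> j \<in> {1..n}"
  by (simp add: brandt_def)

lemma brandt_add_Theta [simp]: "brandt_add \<alpha> Theta = Theta"
  by (cases \<alpha>) auto

lemma brandt_add_closed: "\<alpha> \<in> brandt n \<Longrightarrow> \<beta> \<in> brandt n \<Longrightarrow> brandt_add \<alpha> \<beta> \<in> brandt n"
  by (cases \<alpha>; cases \<beta>) auto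

lemma brandt_add_assoc: "brandt_add (brandt_add \<alpha> \<beta>) \<gamma> = brandt_add \<alpha> (brandt_add \<beta> \<gamma>)"
  by (cases \<alpha>; cases \<beta>; cases \<gamma>) auto

lemma pw_add_assoc: "pw_add n (pw_add n f g) h = pw_add n f (pw_add n g h)"
  by (simp add: pw_add_def fun_eq_iff restrict_def brandt_add_assoc)

text \<open>Phrased with the inequalities into which the simplifier unfolds membership in
  \<open>{1..n}\<close>.\<close>

lemma permutes_interval_iff: "\<sigma> permutes {1..n} \<Longrightarrow> Suc 0 \<le> \<sigma> i \<and> \<sigma> i \<le> n \<longleftrightarrow> Suc 0 \<le> i \<and> i \<le> n"
  using permutes_in_image[of \<sigma> "{1..n}" i] by simp

lemma codes_add: "codes n a \<Longrightarrow> codes n b \<Longrightarrow> codes n (code_add a b)"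
  by (cases a; cases b) (auto simp: permutes_in_image permutes_inv simp del: atLeastAtMost_iff)

lemma codes_comp: "codes n a \<Longrightarrow> codes n b \<Longrightarrow> codes n (code_comp a b)"
  by (cases a; cases b) (auto simp: permutes_in_image permutes_inv permutes_compose simp del: atLeastAtMost_iff)

lemma apply_code_closed: "codes n c \<Longrightarrow> \<alpha> \<in> brandt n \<Longrightarrow> apply_code c \<alpha> \<in> brandt n"
  by (cases c; cases \<alpha>) (auto simp: permutes_in_image simp del: atLeastAtMost_iff)

text \<open>No carrier condition on \<open>\<alpha>\<close> arises: a permutation of
  \<open>{1..n}\<close> is a bijection of all naturals, so the row singled out by \<open>inv\<close>
  is unique everywhere.\<close>

lemma apply_code_add:
  assumes "codes n a" "codes n b"
  shows "apply_code (code_add a b) \<alpha> = brandt_add (apply_code a \<alpha>) (apply_code b \<alpha>)"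
  using assms by (cases a; cases b; cases \<alpha>) (auto simp: permutes_inv_eq permutes_inverses)

lemma apply_code_comp:
  assumes "codes n a" "codes n b"
  shows "apply_code (code_comp a b) \<alpha> = apply_code b (apply_code a \<alpha>)"
  using assms by (cases a; cases b; cases \<alpha>) (auto simp: permutes_inv_eq permutes_inverses)

lemma decode_add:
  "codes n a \<Longrightarrow> codes n b \<Longrightarrow> pw_add n (decode n a) (decode n b) = decode n (code_add a b)"
  by (auto simp: pw_add_def decode_def apply_code_add fun_eq_iff)

lemma decode_comp:
  "codes n a \<Longrightarrow> codes n b \<Longrightarrow> fn_comp n (decode n a) (decode n b) = decode n (code_comp a b)"
  by (auto simp: fn_comp_def compose_def decode_def apply_code_comp fun_eq_iff apply_code_closed)

text \<open>Only a \<open>Const\<close> is nonzero at \<open>Theta\<close>. The other kinds differ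
  in the size of their support, which is 0, \<open>n\<close> or 1; for \<open>n = 1\<close> columns
  and points would coincide.\<close>

lemma inj_on_decode:
  assumes "n \<ge> 2"
  shows "inj_on (decode n) (Collect (codes n))"
proof (rule inj_onI)
  fix a b
  assume ab: "a \<in> Collect (codes n)" "b \<in> Collect (codes n)" and eq: "decode n a = decode n b"
  have E: "apply_code a \<alpha> = apply_code b \<alpha>" if "\<alpha> \<in> brandt n" for \<alpha>
    using fun_cong[OF eq, of \<alpha>] that by (simp add: decode_def)
  have Th: "apply_code a Theta = apply_code b Theta"
    by (rule E) simp
  have P: "apply_code a (Pr i j) = apply_code b (Pr i j)" if "i \<in> {1..n}" "j \<in> {1..n}" for i j
    using that by (intro E) simp
  \<comment> \<open>A second row, on which a column is nonzero while a point supported on row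
    \<open>i\<close> vanishes.\<close>
  have two: "\<exists>j\<in>{1..n}. j \<noteq> i" for i
    using assms by (intro bexI[of _ "if i = 1 then 2 else 1"]) auto
  have perm: "\<sigma> = \<tau>" if "\<sigma> permutes {1..n}" "\<tau> permutes {1..n}" "\<And>i. i \<in> {1..n} \<Longrightarrow> \<sigma> i = \<tau> i" for \<sigma> \<tau>
  proof
    fix i
    show "\<sigma> i = \<tau> i"
      using that permutes_not_in[of \<sigma> _ i] permutes_not_in[of \<tau> _ i] by (cases "i \<in> {1..n}") auto
  qed
  show "a = b"
  proof (cases a)
    case Zero
    show ?thesis
    proof (cases b)
      case (Column k q \<sigma>)
      then show ?thesis using P[of 1 k] ab assms Zero by auto
    next
      case (Point i k p q)
      then show ?thesis using P[of i k] ab Zero by auto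
    qed (use Th Zero in auto)
  next
    case (Const p q)
    then show ?thesis using Th by (cases b) auto
  next
    case (Column k q \<sigma>)
    show ?thesis
    proof (cases b)
      case Zero
      then show ?thesis using P[of 1 k] ab assms Column by auto
    next
      case (Column k' q' \<tau>)
      \<comment> \<open>The first column is nonzero at \<open>(1,k)\<close>, so the second one is
        too, and the second components agree there.\<close>
      then have *: "k = k'" "q = q'"
        using P[of 1 k] ab assms \<open>a = Column k q \<sigma>\<close> by (auto split: if_splits)
      then have "\<sigma> i = \<tau> i" if "i \<in> {1..n}" for i
        using P[of i k] that ab \<open>a = Column k q \<sigma>\<close> Column by auto
      then show ?thesis
        using perm[of \<sigma> \<tau>] ab * \<open>a = Column k q \<sigma>\<close> Column by auto
    next
      case (Point i k' p q')
      obtain j where "j \<in> {1..n}" "j \<noteq> i" using two by blast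
      then show ?thesis using P[of j k] ab \<open>a = Column k q \<sigma>\<close> Point by auto
    qed (use Th Column in auto)
  next
    case (Point i k p q)
    show ?thesis
    proof (cases b)
      case (Column k' q' \<sigma>)
      obtain j where "j \<in> {1..n}" "j \<noteq> i" using two by blast
      then show ?thesis using P[of j k'] ab \<open>a = Point i k p q\<close> Column by auto
    next
      case (Point i' k' p' q')
      then show ?thesis using P[of i k] ab \<open>a = Point i k p q\<close> by (auto split: if_splits)
    next
      case Zero
      then show ?thesis using P[of i k] ab Point by auto
    qed (use Th Point in auto)
  qed
qed

section \<open>Endomorphisms and the elements of the affine near-semiring\<close>

text \<open>The split is by the image of \<open>Theta\<close> and by whether some pair is sent to
  \<open>Theta\<close>. If neither happens to degenerate, the nonzero idempotents
  \<open>(i,i)\<close> are permuted, and they determine the rest.\<close>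

lemma brandt_endos_cases:
  assumes "g \<in> brandt_endos n"
  obtains (const) c where "c \<in> brandt n" "g = (\<lambda>\<alpha>\<in>brandt n. c)"
  | (perm) \<sigma> where "\<sigma> permutes {1..n}" "g Theta = Theta"
      "\<And>i j. i \<in> {1..n} \<Longrightarrow> j \<in> {1..n} \<Longrightarrow> g (Pr i j) = Pr (\<sigma> i) (\<sigma> j)"
proof -
  have ext: "g \<in> extensional (brandt n)"
    using assms by (simp add: brandt_endos_def brandt_maps_def PiE_iff)
  have cl: "g \<alpha> \<in> brandt n" if "\<alpha> \<in> brandt n" for \<alpha>
    using assms that by (simp add: brandt_endos_def brandt_maps_def PiE_iff)
  have hom: "g (brandt_add \<alpha> \<beta>) = brandt_add (g \<alpha>) (g \<beta>)"
    if "\<alpha> \<in> brandt n" "\<beta> \<in> brandt n" for \<alpha> \<beta>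
    using assms that by (simp add: brandt_endos_def)
  have constI: thesis if "c \<in> brandt n" "\<And>\<alpha>. \<alpha> \<in> brandt n \<Longrightarrow> g \<alpha> = c" for c
  proof -
    have "g = (\<lambda>\<alpha>\<in>brandt n. c)"
      by (rule extensionalityI[OF ext]) (simp_all add: that(2))
    with that(1) show thesis by (rule const)
  qed
  show thesis
  proof (cases "g Theta")
    case (Pr k l)
    \<comment> \<open>\<open>g Theta\<close> absorbs \<open>g \<alpha>\<close> from both sides;
      between two pairs this forces all components to be equal.\<close>
    have "g \<alpha> = Pr k l" if "\<alpha> \<in> brandt n" for \<alpha>
    proof (cases "g \<alpha>")
      case (Pr a b)
      with \<open>g Theta = Pr k l\<close> show ?thesis
        using hom[OF that Theta_in_brandt] hom[OF Theta_in_brandt that]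
        by (simp add: Pr split: if_splits)
    next
      case Theta
      with Pr show ?thesis
        using hom[OF that Theta_in_brandt] by (simp add: Theta)
    qed
    then show thesis using constI[of "Pr k l"] cl[of Theta] Pr by simp
  next
    case Theta
    show thesis
    proof (cases "\<exists>i\<in>{1..n}. \<exists>j\<in>{1..n}. g (Pr i j) = Theta")
      case True
      then obtain i j where ij: "i \<in> {1..n}" "j \<in> {1..n}" "g (Pr i j) = Theta" by blast
      have "g \<alpha> = Theta" if \<alpha>: "\<alpha> \<in> brandt n" for \<alpha>
      proof (cases \<alpha>)
        case (Pr k l)
        \<comment> \<open>Every pair factors through \<open>(i,j)\<close>, so one pair sent to
          \<open>Theta\<close> drags all others along.\<close>
        have "g \<alpha> = g (brandt_add (brandt_add (Pr k i) (Pr i j)) (Pr j l))"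
          using Pr by simp
        also have "\<dots> = brandt_add (g (brandt_add (Pr k i) (Pr i j))) (g (Pr j l))"
          using \<alpha> ij Pr by (intro hom) auto
        also have "g (brandt_add (Pr k i) (Pr i j)) = brandt_add (g (Pr k i)) (g (Pr i j))"
          using \<alpha> ij Pr by (intro hom) auto
        finally show ?thesis using ij by simp
      qed (use Theta in simp)
      then show thesis using constI[of Theta] by simp
    next
      case False
      \<comment> \<open>The nonzero idempotents of the Brandt semigroup are the diagonal pairs, so
        such a \<open>p\<close> exists. The value \<open>i\<close> off \<open>{1..n}\<close> is what
        \<open>permutes\<close> demands.\<close>
      define \<sigma> where "\<sigma> i = (if i \<in> {1..n} then SOME p. g (Pr i i) = Pr p p else i)" for i
      have nz: "\<exists>a b. g (Pr i j) = Pr a b" if "i \<in> {1..n}" "j \<in> {1..n}" for i j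
        using that False by (cases "g (Pr i j)") auto
      have idem: "g (Pr i i) = Pr (\<sigma> i) (\<sigma> i)" if i: "i \<in> {1..n}" for i
      proof -
        obtain a b where ab: "g (Pr i i) = Pr a b" using nz[OF i i] by blast
        have "g (brandt_add (Pr i i) (Pr i i)) = brandt_add (g (Pr i i)) (g (Pr i i))"
          using i by (intro hom) simp_all
        then have "g (Pr i i) = Pr a a" by (simp add: ab split: if_splits)
        then have "g (Pr i i) = Pr (SOME p. g (Pr i i) = Pr p p) (SOME p. g (Pr i i) = Pr p p)"
          by (rule someI)
        then show ?thesis using i by (simp add: \<sigma>_def)
      qed
      have val: "g (Pr i j) = Pr (\<sigma> i) (\<sigma> j)" if ij: "i \<in> {1..n}" "j \<in> {1..n}" for i j
      proof -
        obtain a b where ab: "g (Pr i j) = Pr a b" using nz[OF ij] by blast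
        \<comment> \<open>\<open>(i,i)\<close> and \<open>(j,j)\<close> are one-sided identities for
          \<open>(i,j)\<close>. If a component of the image failed to match, the sum would be
          \<open>Theta\<close>.\<close>
        have left: "g (brandt_add (Pr i i) (Pr i j)) = brandt_add (g (Pr i i)) (g (Pr i j))"
          using ij by (intro hom) simp_all
        have right: "g (brandt_add (Pr i j) (Pr j j)) = brandt_add (g (Pr i j)) (g (Pr j j))"
          using ij by (intro hom) simp_all
        have "\<sigma> i = a"
        proof (rule ccontr)
          assume "\<sigma> i \<noteq> a"
          then show False using left by (simp add: ab idem[OF ij(1)])
        qed
        moreover have "b = \<sigma> j"
        proof (rule ccontr)
          assume "b \<noteq> \<sigma> j"
          then show False using right by (simp add: ab idem[OF ij(2)])
        qed
        ultimately show ?thesis using ab by simp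
      qed
      \<comment> \<open>Distinct diagonal pairs add up to \<open>Theta\<close>, which
        \<open>g\<close> fixes, but a common image would be idempotent and nonzero.\<close>
      have inj: "inj_on \<sigma> {1..n}"
      proof (rule inj_onI, rule ccontr)
        fix i j assume "i \<in> {1..n}" "j \<in> {1..n}" "\<sigma> i = \<sigma> j" "i \<noteq> j"
        then show False using hom[of "Pr i i" "Pr j j"] idem[of i] idem[of j] Theta by auto
      qed
      have "\<sigma> ` {1..n} \<subseteq> {1..n}"
        using cl[of "Pr i i" for i] by (auto simp: idem simp del: atLeastAtMost_iff)
      then have "bij_betw \<sigma> {1..n} {1..n}"
        using inj by (simp add: bij_betw_def endo_inj_surj)
      then have "\<sigma> permutes {1..n}"
        by (rule bij_imp_permutes) (auto simp: \<sigma>_def)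
      then show thesis using perm[of \<sigma>] Theta val by blast
    qed
  qed
qed

section \<open>Every affine map has a code, and every code occurs\<close>

lemma decode_eqI:
  "f \<in> extensional (brandt n) \<Longrightarrow> (\<And>\<alpha>. \<alpha> \<in> brandt n \<Longrightarrow> f \<alpha> = apply_code c \<alpha>) \<Longrightarrow> f = decode n c"
  by (auto simp: decode_def intro: extensionalityI)

lemma const_in_decode:
  assumes "c \<in> brandt n"
  shows "(\<lambda>\<alpha>\<in>brandt n. c) \<in> decode n ` Collect (codes n)"
proof (cases c)
  case (Pr p q)
  with assms show ?thesis
    by (intro image_eqI[of _ _ "Const p q"]) (auto simp: decode_def)
next
  case Theta
  then show ?thesis
    by (intro image_eqI[of _ _ Zero]) (auto simp: decode_def)
qed

lemma affine_maps_subset: "affine_maps n \<subseteq> decode n ` Collect (codes n)"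
proof
  fix f assume "f \<in> affine_maps n"
  then obtain g c where g: "g \<in> brandt_endos n" and c: "c \<in> brandt n"
    and f: "f = pw_add n g (\<lambda>\<alpha>\<in>brandt n. c)"
    by (auto simp: affine_maps_def const_maps_def)
  from g show "f \<in> decode n ` Collect (codes n)"
  proof (cases rule: brandt_endos_cases)
    case (const d)
    then have "f = (\<lambda>\<alpha>\<in>brandt n. brandt_add d c)"
      using f by (auto simp: pw_add_def)
    then show ?thesis
      using const_in_decode brandt_add_closed const c by metis
  next
    case (perm \<sigma>)
    have ext: "f \<in> extensional (brandt n)"
      by (simp add: f pw_add_def)
    show ?thesis
    proof (cases c)
      case (Pr p q)
      \<comment> \<open>\<open>(\<sigma> i, \<sigma> j) + (p,q)\<close> is nonzero exactly when
        \<open>\<sigma> j = p\<close>, which selects the column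
        \<open>j = inv \<sigma> p\<close>.\<close>
      have "f = decode n (Column (inv \<sigma> p) q \<sigma>)"
      proof (rule decode_eqI[OF ext])
        fix \<alpha> assume "\<alpha> \<in> brandt n"
        then show "f \<alpha> = apply_code (Column (inv \<sigma> p) q \<sigma>) \<alpha>"
          using perm Pr by (cases \<alpha>) (auto simp: f pw_add_def permutes_inverses)
      qed
      moreover have "codes n (Column (inv \<sigma> p) q \<sigma>)"
        using c Pr permutes_in_image[OF permutes_inv[OF perm(1)]] perm(1) by simp
      ultimately show ?thesis by blast
    next
      case Theta
      then have "f = decode n Zero"
        by (intro decode_eqI[OF ext]) (simp add: f pw_add_def)
      then show ?thesis by (rule image_eqI) simp
    qed
  qed
qed

text \<open>A constant map is an endomorphism only if its value is idempotent. So the value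
  \<open>c\<close> is written as \<open>d + c\<close> with \<open>d\<close> an idempotent left
  identity of \<open>c\<close>, namely \<open>(p,p)\<close> for \<open>c = (p,q)\<close>.\<close>

lemma const_in_affine_nsr:
  assumes "c \<in> brandt n"
  shows "(\<lambda>\<alpha>\<in>brandt n. c) \<in> affine_nsr n"
proof -
  have "\<exists>d\<in>brandt n. brandt_add d d = d \<and> brandt_add d c = c"
  proof (cases c)
    case (Pr p q)
    then show ?thesis using assms by (intro bexI[of _ "Pr p p"]) auto
  next
    case Theta
    then show ?thesis by (intro bexI[of _ Theta]) auto
  qed
  then obtain d where d: "d \<in> brandt n" "brandt_add d d = d" "brandt_add d c = c"
    by blast
  have "(\<lambda>\<alpha>\<in>brandt n. d) \<in> brandt_endos n"
    using d by (auto simp: brandt_endos_def brandt_maps_def brandt_add_closed)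
  moreover have "(\<lambda>\<alpha>\<in>brandt n. c) = pw_add n (\<lambda>\<alpha>\<in>brandt n. d) (\<lambda>\<alpha>\<in>brandt n. c)"
    using d by (auto simp: pw_add_def)
  ultimately have "(\<lambda>\<alpha>\<in>brandt n. c) \<in> affine_maps n"
    using assms unfolding affine_maps_def const_maps_def by blast
  then show ?thesis by (rule affine_nsr.affine)
qed

lemma Column_in_affine_nsr:
  assumes "codes n (Column k q \<sigma>)"
  shows "decode n (Column k q \<sigma>) \<in> affine_nsr n"
proof -
  define g where "g = (\<lambda>\<alpha>\<in>brandt n. case \<alpha> of Pr i j \<Rightarrow> Pr (\<sigma> i) (\<sigma> j) | Theta \<Rightarrow> Theta)"
  have \<sigma>: "\<sigma> permutes {1..n}" using assms by simp
  have eq: "\<sigma> i = \<sigma> j \<longleftrightarrow> i = j" for i j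
    using permutes_inj[OF \<sigma>] by (auto dest: injD)
  have "g \<in> brandt_maps n"
    using \<sigma> by (auto simp: g_def brandt_maps_def permutes_interval_iff split: brandt_elem.splits)
  moreover have "g (brandt_add \<alpha> \<beta>) = brandt_add (g \<alpha>) (g \<beta>)"
    if "\<alpha> \<in> brandt n" "\<beta> \<in> brandt n" for \<alpha> \<beta>
    using that by (cases \<alpha>; cases \<beta>) (auto simp: g_def eq)
  ultimately have "g \<in> brandt_endos n"
    by (simp add: brandt_endos_def)
  \<comment> \<open>Adding \<open>(\<sigma> k, q)\<close> keeps exactly the pairs
    \<open>(i,j)\<close> with \<open>\<sigma> j = \<sigma> k\<close>, that is, the column
    \<open>k\<close>.\<close>
  moreover have "decode n (Column k q \<sigma>) = pw_add n g (\<lambda>\<alpha>\<in>brandt n. Pr (\<sigma> k) q)"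
  proof (rule decode_eqI[symmetric])
    fix \<alpha> assume "\<alpha> \<in> brandt n"
    then show "pw_add n g (\<lambda>\<alpha>\<in>brandt n. Pr (\<sigma> k) q) \<alpha> = apply_code (Column k q \<sigma>) \<alpha>"
      by (cases \<alpha>) (auto simp: pw_add_def g_def eq)
  qed (simp add: pw_add_def)
  moreover have "(\<lambda>\<alpha>\<in>brandt n. Pr (\<sigma> k) q) \<in> const_maps n"
    using assms \<sigma> unfolding const_maps_def by (auto simp: permutes_interval_iff)
  ultimately have "decode n (Column k q \<sigma>) \<in> affine_maps n"
    unfolding affine_maps_def by blast
  then show ?thesis by (rule affine_nsr.affine)
qed

lemma affine_nsr_eq: "affine_nsr n = decode n ` Collect (codes n)"
proof (intro subset_antisym subsetI)
  fix f assume "f \<in> affine_nsr n"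
  then show "f \<in> decode n ` Collect (codes n)"
  proof induction
    case (affine f)
    then show ?case using affine_maps_subset by blast
  next
    case (add f g)
    then show ?case by (auto simp: decode_add codes_add)
  next
    case (comp f g)
    then show ?case by (auto simp: decode_comp codes_comp)
  qed
next
  fix f assume "f \<in> decode n ` Collect (codes n)"
  then obtain c where c: "codes n c" and f: "f = decode n c" by blast
  have const: "decode n (Const p q) \<in> affine_nsr n" if "codes n (Const p q)" for p q
    using const_in_affine_nsr[of "Pr p q" n] that by (simp add: decode_def)
  show "f \<in> affine_nsr n"
  proof (cases c)
    case Zero
    then show ?thesis using const_in_affine_nsr[of Theta n] f by (simp add: decode_def)
  next
    case (Const p q)
    then show ?thesis using const c f by simp
  next
    case (Column k q \<sigma>)
    then show ?thesis using Column_in_affine_nsr c f by simp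
  next
    case (Point i k p q)
    \<comment> \<open>In \<open>(p,i) + (j,q)\<close> only the row \<open>j = i\<close> survives, so
      this sum is the desired point.\<close>
    then have *: "codes n (Const p i)" "codes n (Column k q id)"
      using c permutes_id[of "{1..n}"] by auto
    then have "f = pw_add n (decode n (Const p i)) (decode n (Column k q id))"
      by (subst decode_add) (simp_all add: f Point)
    then show ?thesis using affine_nsr.add const Column_in_affine_nsr * by simp
  qed
qed

lemma decode_in_affine_nsr: "codes n c \<Longrightarrow> decode n c \<in> affine_nsr n"
  by (simp add: affine_nsr_eq)

section \<open>Green's relations on codes\<close>

text \<open>Picks a representative of the \<R>-class. Right addition can reset the second component
  freely, and 1 is an arbitrary choice for it.\<close>

fun row_normal :: "code \<Rightarrow> code" where
  "row_normal Zero = Zero"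
| "row_normal (Const p q) = Const p 1"
| "row_normal (Column k q \<sigma>) = Column k 1 \<sigma>"
| "row_normal (Point i k p q) = Point i k p 1"

text \<open>Representative of the \<L>-class. Columns fall under the last clause and stay unchanged,
  since each is alone in its class.\<close>

fun col_normal :: "code \<Rightarrow> code" where
  "col_normal (Const p q) = Const 1 q"
| "col_normal (Point i k p q) = Point i k 1 q"
| "col_normal c = c"

text \<open>A measure that falls whenever an addition leaves the class. Columns lie between the
  other nonzero kinds because a column plus a constant can be a column, while a constant plus a
  column is a point.\<close>

fun rank :: "code \<Rightarrow> nat" where
  "rank Zero = 0"
| "rank (Point i k p q) = 1"
| "rank (Column k q \<sigma>) = 2"
| "rank (Const p q) = 3"

lemma rank_add_left: "row_normal (code_add a c) = row_normal a \<or> rank (code_add a c) < rank a"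
  by (cases a; cases c) auto

lemma rank_add_right: "col_normal (code_add c a) = col_normal a \<or> rank (code_add c a) < rank a"
  by (cases a; cases c) auto

section \<open>Principal ideals computed on codes\<close>

lemma right_ideal_eq_iff:
  assumes "\<And>x y. x \<in> S \<Longrightarrow> y \<in> S \<Longrightarrow> p x y \<in> S"
    and "\<And>x y z. p (p x y) z = p x (p y z)"
  shows "right_ideal S p a = right_ideal S p b \<longleftrightarrow> a \<in> right_ideal S p b \<and> b \<in> right_ideal S p a"
proof
  have "right_ideal S p x \<subseteq> right_ideal S p y" if "x \<in> right_ideal S p y" for x y
    using that assms by (fastforce simp: right_ideal_def)
  then show "right_ideal S p a = right_ideal S p b" if "a \<in> right_ideal S p b \<and> b \<in> right_ideal S p a"
    using that by blast
qed (simp add: right_ideal_def, blast)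

lemma left_ideal_eq_iff:
  assumes "\<And>x y. x \<in> S \<Longrightarrow> y \<in> S \<Longrightarrow> p x y \<in> S"
    and "\<And>x y z. p (p x y) z = p x (p y z)"
  shows "left_ideal S p a = left_ideal S p b \<longleftrightarrow> a \<in> left_ideal S p b \<and> b \<in> left_ideal S p a"
proof
  have "left_ideal S p x \<subseteq> left_ideal S p y" if "x \<in> left_ideal S p y" for x y
    using that assms(1) by (fastforce simp: left_ideal_def simp flip: assms(2))
  then show "left_ideal S p a = left_ideal S p b" if "a \<in> left_ideal S p b \<and> b \<in> left_ideal S p a"
    using that by blast
qed (simp add: left_ideal_def, blast)

text \<open>Moves ideal membership from maps to codes by injectivity of \<open>decode\<close>. The
  disjunct \<open>a = b\<close> stems from the adjoined identity.\<close>

lemma decode_in_right_ideal: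
  assumes "n \<ge> 2" "codes n a" "codes n b"
  shows "decode n a \<in> right_ideal (affine_nsr n) (pw_add n) (decode n b)
    \<longleftrightarrow> a = b \<or> (\<exists>c. codes n c \<and> a = code_add b c)"
proof -
  have "{pw_add n (decode n b) s | s. s \<in> affine_nsr n} = (\<lambda>c. decode n (code_add b c)) ` Collect (codes n)"
    using assms by (auto simp: affine_nsr_eq Setcompr_eq_image image_image decode_add intro!: image_cong)
  then have "decode n a \<in> right_ideal (affine_nsr n) (pw_add n) (decode n b)
      \<longleftrightarrow> decode n a = decode n b \<or> (\<exists>c. codes n c \<and> decode n a = decode n (code_add b c))"
    by (auto simp: right_ideal_def)
  then show ?thesis
    using assms inj_on_decode[of n] by (auto simp: inj_on_eq_iff codes_add)
qed

lemma decode_in_left_ideal: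
  assumes "n \<ge> 2" "codes n a" "codes n b"
  shows "decode n a \<in> left_ideal (affine_nsr n) (pw_add n) (decode n b)
    \<longleftrightarrow> a = b \<or> (\<exists>c. codes n c \<and> a = code_add c b)"
proof -
  have "{pw_add n s (decode n b) | s. s \<in> affine_nsr n} = (\<lambda>c. decode n (code_add c b)) ` Collect (codes n)"
    using assms by (auto simp: affine_nsr_eq Setcompr_eq_image image_image decode_add intro!: image_cong)
  then have "decode n a \<in> left_ideal (affine_nsr n) (pw_add n) (decode n b)
      \<longleftrightarrow> decode n a = decode n b \<or> (\<exists>c. codes n c \<and> decode n a = decode n (code_add c b))"
    by (auto simp: left_ideal_def)
  then show ?thesis
    using assms inj_on_decode[of n] by (auto simp: inj_on_eq_iff codes_add)
qed

lemma green_R_decode: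
  assumes "n \<ge> 2" "codes n a" "codes n b"
  shows "(decode n a, decode n b) \<in> green_R (affine_nsr n) (pw_add n) \<longleftrightarrow> row_normal a = row_normal b"
proof -
  let ?le = "\<lambda>a b. a = b \<or> (\<exists>c. codes n c \<and> a = code_add b c)"
  have ideals: "(decode n a, decode n b) \<in> green_R (affine_nsr n) (pw_add n) \<longleftrightarrow> ?le a b \<and> ?le b a"
    using assms by (simp add: green_R_def right_ideal_eq_iff[OF affine_nsr.add pw_add_assoc]
        decode_in_right_ideal decode_in_affine_nsr)
  have normal: "?le a b \<and> ?le b a \<longleftrightarrow> row_normal a = row_normal b"
  proof
    \<comment> \<open>If the normal forms differed, each of \<open>a\<close> and \<open>b\<close>
      would have smaller rank than the other.\<close>
    have le: "row_normal a = row_normal b \<or> rank a < rank b" if "?le a b" for a b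
      using that rank_add_left by metis
    show "row_normal a = row_normal b" if "?le a b \<and> ?le b a"
      using le[OF that[THEN conjunct1]] le[OF that[THEN conjunct2]] by auto
  next
    assume eq: "row_normal a = row_normal b"
    \<comment> \<open>For nonzero \<open>x\<close> the witness is the constant \<open>(r,q)\<close>,
      which turns the second component \<open>r\<close> of \<open>y\<close> into the
      \<open>q\<close> of \<open>x\<close>.\<close>
    have "\<exists>c. codes n c \<and> x = code_add y c"
      if xy: "codes n x" "codes n y" "row_normal x = row_normal y" for x y
    proof (cases x)
      case Zero
      then show ?thesis using xy by (intro exI[of _ Zero]) (cases y; auto)
    next
      case (Const p q)
      then obtain r where "y = Const p r" using xy by (cases y) auto
      then show ?thesis using xy Const by (intro exI[of _ "Const r q"]) auto
    next
      case (Column k q \<sigma>)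
      then obtain r where "y = Column k r \<sigma>" using xy by (cases y) auto
      then show ?thesis using xy Column by (intro exI[of _ "Const r q"]) auto
    next
      case (Point i k p q)
      then obtain r where "y = Point i k p r" using xy by (cases y) auto
      then show ?thesis using xy Point by (intro exI[of _ "Const r q"]) auto
    qed
    then show "?le a b \<and> ?le b a" using assms(2,3) eq by metis
  qed
  show ?thesis using ideals normal by (rule trans)
qed

lemma green_L_decode:
  assumes "n \<ge> 2" "codes n a" "codes n b"
  shows "(decode n a, decode n b) \<in> green_L (affine_nsr n) (pw_add n) \<longleftrightarrow> col_normal a = col_normal b"
proof -
  let ?le = "\<lambda>a b. a = b \<or> (\<exists>c. codes n c \<and> a = code_add c b)"
  have ideals: "(decode n a, decode n b) \<in> green_L (affine_nsr n) (pw_add n) \<longleftrightarrow> ?le a b \<and> ?le b a"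
    using assms by (simp add: green_L_def left_ideal_eq_iff[OF affine_nsr.add pw_add_assoc]
        decode_in_left_ideal decode_in_affine_nsr)
  have normal: "?le a b \<and> ?le b a \<longleftrightarrow> col_normal a = col_normal b"
  proof
    have le: "col_normal a = col_normal b \<or> rank a < rank b" if "?le a b" for a b
      using that rank_add_right by metis
    show "col_normal a = col_normal b" if "?le a b \<and> ?le b a"
      using le[OF that[THEN conjunct1]] le[OF that[THEN conjunct2]] by auto
  next
    assume eq: "col_normal a = col_normal b"
    have "?le x y" if xy: "codes n x" "codes n y" "col_normal x = col_normal y" for x y
    proof (cases x)
      case Zero
      then show ?thesis using xy by (cases y) auto
    next
      case (Const p q)
      then obtain r where "y = Const r q" using xy by (cases y) auto
      then show ?thesis using xy Const by (intro disjI2 exI[of _ "Const p r"]) auto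
    next
      \<comment> \<open>Here \<open>y = x\<close>, and only the disjunct for the adjoined identity
        applies: adding anything on the left of a column gives a point or
        \<open>Zero\<close>.\<close>
      case (Column k q \<sigma>)
      then show ?thesis using xy by (cases y) auto
    next
      case (Point i k p q)
      then obtain r where "y = Point i k r q" using xy by (cases y) auto
      then show ?thesis using xy Point by (intro disjI2 exI[of _ "Const p r"]) auto
    qed
    then show "?le a b \<and> ?le b a" using assms(2,3) eq by metis
  qed
  show ?thesis using ideals normal by (rule trans)
qed

section \<open>Two-sided normal forms and the relation \<D>\<close>

lemma codes_row_normal: "n \<ge> 2 \<Longrightarrow> codes n c \<Longrightarrow> codes n (row_normal c)"
  by (cases c) auto

lemma codes_col_normal: "n \<ge> 2 \<Longrightarrow> codes n c \<Longrightarrow> codes n (col_normal c)"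
  by (cases c) auto

lemma normal_commute: "row_normal (col_normal c) = col_normal (row_normal c)"
  by (cases c) auto

lemma row_normal_idem: "row_normal (row_normal c) = row_normal c"
  by (cases c) auto

lemma col_normal_idem: "col_normal (col_normal c) = col_normal c"
  by (cases c) auto

text \<open>Since the two normalizations commute, their composite is invariant under both \<L> and
  \<R>, hence along chains. Conversely, one \<R>-step and one \<L>-step lead from a code to its
  two-sided normal form.\<close>

lemma green_D_decode:
  assumes "n \<ge> 2" "codes n a" "codes n b"
  shows "(decode n a, decode n b) \<in> green_D (affine_nsr n) (pw_add n)
    \<longleftrightarrow> col_normal (row_normal a) = col_normal (row_normal b)"
proof
  let ?S = "affine_nsr n"
  let ?D = "green_D ?S (pw_add n)"
  have invariant: "col_normal (row_normal x) = col_normal (row_normal y)"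
    if "codes n x" "codes n y"
      "(decode n x, decode n y) \<in> green_L ?S (pw_add n) \<union> green_R ?S (pw_add n)" for x y
    using that assms(1) by (auto simp: green_L_decode green_R_decode) (metis normal_commute)
  \<comment> \<open>The chain runs through maps, so the induction carries a code for the current
    map. Injectivity of \<open>decode\<close> later identifies the last code with
    \<open>b\<close>.\<close>
  have "\<exists>c. codes n c \<and> f = decode n c \<and> col_normal (row_normal a) = col_normal (row_normal c)"
    if "(decode n a, f) \<in> ?D" for f
    using that unfolding green_D_def
  proof induction
    case (base f)
    then obtain c where "codes n c" "f = decode n c"
      by (auto simp: green_L_def green_R_def affine_nsr_eq)
    then show ?case using invariant base assms by blast
  next
    case (step f g)
    then obtain c d where "codes n c" "f = decode n c" "codes n d" "g = decode n d"
      "col_normal (row_normal a) = col_normal (row_normal c)"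
      by (auto simp: green_L_def green_R_def affine_nsr_eq)
    then show ?case using invariant step by metis
  qed
  then obtain c where "codes n c" "decode n b = decode n c"
    "col_normal (row_normal a) = col_normal (row_normal c)"
    if "(decode n a, decode n b) \<in> ?D"
    by blast
  then show "col_normal (row_normal a) = col_normal (row_normal b)"
    if "(decode n a, decode n b) \<in> ?D"
    using that assms by (simp add: inj_on_eq_iff[OF inj_on_decode])
  have D: "(decode n c, decode n (col_normal (row_normal c))) \<in> ?D" if "codes n c" for c
  proof -
    have "(decode n c, decode n (row_normal c)) \<in> green_R ?S (pw_add n)"
      using that assms(1) by (simp add: green_R_decode codes_row_normal row_normal_idem)
    moreover have "(decode n (row_normal c), decode n (col_normal (row_normal c))) \<in> green_L ?S (pw_add n)"
      using that assms(1)
      by (simp add: green_L_decode codes_row_normal codes_col_normal col_normal_idem)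
    ultimately show ?thesis
      unfolding green_D_def by (meson UnI1 UnI2 r_into_trancl trancl_trans)
  qed
  show "(decode n a, decode n b) \<in> ?D" if "col_normal (row_normal a) = col_normal (row_normal b)"
  proof -
    have "sym ?D" "trans ?D"
      using equiv_green_D[of ?S "pw_add n"] by (auto elim: equivE)
    then show ?thesis
      using D[OF assms(2)] D[OF assms(3)] by (metis that symD transD)
  qed
qed

section \<open>Counting the classes\<close>

text \<open>A complete invariant counts the classes. As \<open>f\<close> lives on codes and not on
  maps, \<open>h\<close> reads it off any code whose image lies in the class; the choice does not
  affect the value.\<close>

lemma card_quotient_image:
  assumes "equiv (d ` C) E" and "\<And>a b. a \<in> C \<Longrightarrow> b \<in> C \<Longrightarrow> (d a, d b) \<in> E \<longleftrightarrow> f a = f b"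
  shows "card ((d ` C) // E) = card (f ` C)"
proof -
  define h where "h X = f (SOME a. a \<in> C \<and> d a \<in> X)" for X
  have h: "h (E `` {d a}) = f a" if "a \<in> C" for a
  proof -
    define b where "b = (SOME b. b \<in> C \<and> d b \<in> E `` {d a})"
    have "a \<in> C \<and> d a \<in> E `` {d a}"
      using that assms(2) by simp
    then have "b \<in> C \<and> d b \<in> E `` {d a}"
      unfolding b_def by (rule someI)
    then have "f a = f b"
      using that assms(2)[of a b] by simp
    then show ?thesis by (simp only: h_def b_def)
  qed
  have "bij_betw h ((d ` C) // E) (f ` C)"
  proof (rule bij_betw_imageI)
    show "inj_on h ((d ` C) // E)"
    proof (rule inj_onI)
      fix X Y assume "X \<in> (d ` C) // E" "Y \<in> (d ` C) // E" and eq: "h X = h Y"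
      then obtain a b where ab: "a \<in> C" "b \<in> C" "X = E `` {d a}" "Y = E `` {d b}"
        by (auto elim!: quotientE)
      then have "(d a, d b) \<in> E"
        using eq by (simp add: h assms(2))
      then show "X = Y"
        using ab equiv_class_eq[OF assms(1)] by simp
    qed
    show "h ` ((d ` C) // E) = f ` C"
      by (auto simp: quotient_def h image_Union image_UN)
  qed
  then show ?thesis by (rule bij_betw_same_card)
qed

text \<open>One range per coordinate (\<open>K\<close> is shared by columns and points), so that the
  set of all codes and its images under both normalizations are instances of one countable
  shape.\<close>

definition code_set ::
  "nat set \<Rightarrow> nat set \<Rightarrow> nat set \<Rightarrow> nat set \<Rightarrow> (nat \<Rightarrow> nat) set \<Rightarrow> nat set \<Rightarrow> nat set \<Rightarrow> nat set \<Rightarrow> code set" where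
  "code_set A B K Q P I U V = insert Zero
     ((\<lambda>(p, q). Const p q) ` (A \<times> B) \<union> (\<lambda>(k, q, \<sigma>). Column k q \<sigma>) ` (K \<times> Q \<times> P)
      \<union> (\<lambda>(i, k, p, q). Point i k p q) ` (I \<times> K \<times> U \<times> V))"

lemma mem_code_set:
  "Zero \<in> code_set A B K Q P I U V"
  "Const p q \<in> code_set A B K Q P I U V \<longleftrightarrow> p \<in> A \<and> q \<in> B"
  "Column k q \<sigma> \<in> code_set A B K Q P I U V \<longleftrightarrow> k \<in> K \<and> q \<in> Q \<and> \<sigma> \<in> P"
  "Point i k p q \<in> code_set A B K Q P I U V \<longleftrightarrow> i \<in> I \<and> k \<in> K \<and> p \<in> U \<and> q \<in> V"
  by (auto simp: code_set_def image_iff)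

lemma card_code_set:
  assumes "finite A" "finite B" "finite K" "finite Q" "finite P" "finite I" "finite U" "finite V"
  shows "card (code_set A B K Q P I U V)
    = 1 + card A * card B + card K * card Q * card P + card I * card K * card U * card V"
proof -
  have "card ((\<lambda>(p, q). Const p q) ` (A \<times> B)) = card A * card B"
    by (subst card_image) (auto simp: inj_on_def card_cartesian_product)
  moreover have "card ((\<lambda>(k, q, \<sigma>). Column k q \<sigma>) ` (K \<times> Q \<times> P)) = card K * card Q * card P"
    by (subst card_image) (auto simp: inj_on_def card_cartesian_product)
  moreover have "card ((\<lambda>(i, k, p, q). Point i k p q) ` (I \<times> K \<times> U \<times> V)) = card I * card K * card U * card V"
    by (subst card_image) (auto simp: inj_on_def card_cartesian_product)
  ultimately show ?thesis
    unfolding code_set_def using assms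
    by (subst card_insert_disjoint; (subst card_Un_disjoint)?; (subst card_Un_disjoint)?) auto
qed

theorem corollary3p8:
  fixes n :: nat
  assumes "n \<ge> 2"
  shows "card (affine_nsr n // green_R (affine_nsr n) (pw_add n)) = fact n * n + n ^ 3 + n + 1
    \<and> card (affine_nsr n // green_L (affine_nsr n) (pw_add n)) = fact n * n ^ 2 + n ^ 3 + n + 1
    \<and> card (affine_nsr n // green_D (affine_nsr n) (pw_add n)) = fact n * n + n ^ 2 + 2"
proof -
  let ?N = "{1..n}" and ?P = "{\<sigma>. \<sigma> permutes {1..n}}"
  have fin: "finite ?P" by (rule finite_permutations) simp
  have card: "card ?P = fact n" by (rule card_permutations) auto
  have codes: "Collect (codes n) = code_set ?N ?N ?N ?N ?P ?N ?N ?N"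
  proof (rule set_eqI)
    fix c show "c \<in> Collect (codes n) \<longleftrightarrow> c \<in> code_set ?N ?N ?N ?N ?P ?N ?N ?N"
      by (cases c) (simp_all add: mem_code_set)
  qed
  have row: "row_normal ` code_set A ?N K ?N Q I U ?N = code_set A {1} K {1} Q I U {1}"
    (is "_ ` ?X = ?Y") for A K Q I U
  proof (intro subset_antisym subsetI)
    fix c assume "c \<in> ?Y"
    \<comment> \<open>A normalized code is its own preimage, as 1 lies in
      \<open>{1..n}\<close>.\<close>
    then have "c \<in> ?X" "c = row_normal c"
      using assms by (cases c; auto simp: mem_code_set)+
    then show "c \<in> row_normal ` ?X" by (rule image_eqI[rotated])
  next
    fix c assume "c \<in> row_normal ` ?X"
    then obtain d where "d \<in> ?X" "c = row_normal d" by blast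
    then show "c \<in> ?Y" by (cases d) (auto simp: mem_code_set)
  qed
  have col: "col_normal ` code_set ?N B K R Q I ?N V = code_set {1} B K R Q I {1} V"
    (is "_ ` ?X = ?Y") for B K R Q I V
  proof (intro subset_antisym subsetI)
    fix c assume "c \<in> ?Y"
    then have "c \<in> ?X" "c = col_normal c"
      using assms by (cases c; auto simp: mem_code_set)+
    then show "c \<in> col_normal ` ?X" by (rule image_eqI[rotated])
  next
    fix c assume "c \<in> col_normal ` ?X"
    then obtain d where "d \<in> ?X" "c = col_normal d" by blast
    then show "c \<in> ?Y" by (cases d) (auto simp: mem_code_set)
  qed
  note card_affine_nsr_quotient = card_quotient_image[of "decode n" "Collect (codes n)", folded affine_nsr_eq]
  have "card (affine_nsr n // green_R (affine_nsr n) (pw_add n)) = card (row_normal ` Collect (codes n))"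
    by (rule card_affine_nsr_quotient[OF equiv_green_R]) (simp add: green_R_decode[OF assms])
  moreover have "card (affine_nsr n // green_L (affine_nsr n) (pw_add n)) = card (col_normal ` Collect (codes n))"
    by (rule card_affine_nsr_quotient[OF equiv_green_L]) (simp add: green_L_decode[OF assms])
  moreover have "card (affine_nsr n // green_D (affine_nsr n) (pw_add n))
      = card ((\<lambda>c. col_normal (row_normal c)) ` Collect (codes n))"
    by (rule card_affine_nsr_quotient[OF equiv_green_D]) (simp add: green_D_decode[OF assms])
  moreover have "(\<lambda>c. col_normal (row_normal c)) ` X = col_normal ` row_normal ` X" for X
    by (simp add: image_image)
  \<comment> \<open>With the terms in the order zero, constants, columns, points, the counts are
    \<open>1 + n + n * fact n + n^3\<close> for \<R>, \<open>1 + n + n^2 * fact n + n^3\<close> for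
    \<L> and \<open>1 + 1 + n * fact n + n^2\<close> for \<D>.\<close>
  ultimately show ?thesis
    by (simp add: codes row col card_code_set fin card power2_eq_square power3_eq_cube algebra_simps
        del: One_nat_def)
qed

end
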